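(* Let $n\in\mathbb{N}$ and $K\ge 1$. There is a (possibly randomised) stopping rule, chosen without knowledge of the increment distribution and based only on the realised rewards and the sample data below, that attains a prophet constant of $1/4$: for every probability distribution $F$ on $\mathbb{R}$ such that the random walk $S_0=0$, $S_k=\sum_{i=1}^kX_i$ ($0\le k\le n$), with $X_i$ i.i.d. with distribution $F$, has $\mathbb{E}[\max_{0\le k\le n}S_k]<\infty$, the induced stopping time $\tau$ satisfies $$\mathbb{E}[S_\tau^+]\ \ge\ \frac14\,\mathbb{E}\Big[\max_{0\le k\le n}S_k\Big].$$
   Context: Notation: $x^+=\max\{0,x\}$. The sample data are $D=(S_{t,i}^+)_{0\le t\le n,\,1\le i\le K}$, where $(S_{t,i})_{0\le t\le n}$, $i=1,\dots,K$, are independent copies of $(S_k)_{0\le k\le n}$. A (possibly randomised) stopping rule decides at each time $k\le n$ not yet stopped whether to stop, based only on $D$, the observed rewards $S_1^+,\dots,S_k^+$, and independent auxiliary randomness. If it never stops, the reward is $0$. *)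

theory Defs
  imports "HOL-Probability.Probability"
begin

(* The value at time k of the walk with increments x 1, x 2, ... *)
definition walk :: "(nat \<Rightarrow> real) \<Rightarrow> nat \<Rightarrow> real" where
  "walk x k = (\<Sum>i=1..k. x i)"

definition pos_part :: "real \<Rightarrow> real" where
  "pos_part a = max 0 a"

definition walk_max :: "nat \<Rightarrow> (nat \<Rightarrow> real) \<Rightarrow> real" where
  "walk_max n x = Max (walk x ` {0..n})"

definition increments :: "nat \<Rightarrow> real measure \<Rightarrow> (nat \<Rightarrow> real) measure" where
  "increments n F = PiM {1..n} (\<lambda>_. F)"

(* An outcome is (x, y, u): the increments x of the realised walk, the increments y i of the
   i-th sample walk, and the auxiliary random seed u with law A; all are independent. *)
definition joint_law ::
  "nat \<Rightarrow> nat \<Rightarrow> real measure \<Rightarrow> real measure \<Rightarrow>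
     ((nat \<Rightarrow> real) \<times> (nat \<Rightarrow> nat \<Rightarrow> real) \<times> real) measure" where
  "joint_law n K A F =
     increments n F \<Otimes>\<^sub>M (PiM {1..K} (\<lambda>_. increments n F) \<Otimes>\<^sub>M A)"

definition sample_data :: "nat \<Rightarrow> nat \<Rightarrow> (nat \<Rightarrow> nat \<Rightarrow> real) \<Rightarrow> nat \<times> nat \<Rightarrow> real" where
  "sample_data n K y = (\<lambda>(t, i)\<in>{0..n} \<times> {1..K}. pos_part (walk (y i) t))"

definition observed :: "nat \<Rightarrow> (nat \<Rightarrow> real) \<Rightarrow> nat \<Rightarrow> real" where
  "observed k x = (\<lambda>j\<in>{1..k}. pos_part (walk x j))"

(* stop k (d, r, u) is the decision at time k, for sample data d, rewards r observed at the
   times 1, ..., k only (r is undefined elsewhere), and seed u. *)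
type_synonym rule = "nat \<Rightarrow> (nat \<times> nat \<Rightarrow> real) \<times> (nat \<Rightarrow> real) \<times> real \<Rightarrow> bool"

definition randomised_stopping_rule :: "nat \<Rightarrow> nat \<Rightarrow> real measure \<Rightarrow> rule \<Rightarrow> bool" where
  "randomised_stopping_rule n K A stop \<longleftrightarrow>
     real_distribution A \<and>
     (\<forall>k\<le>n. stop k \<in>
        PiM ({0..n} \<times> {1..K}) (\<lambda>_. borel) \<Otimes>\<^sub>M (PiM {1..k} (\<lambda>_. borel) \<Otimes>\<^sub>M A)
          \<rightarrow>\<^sub>M count_space UNIV)"

(* None means that the rule never stops. *)
definition stopping_time ::
  "nat \<Rightarrow> nat \<Rightarrow> rule \<Rightarrow> (nat \<Rightarrow> real) \<times> (nat \<Rightarrow> nat \<Rightarrow> real) \<times> real \<Rightarrow> nat option" where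
  "stopping_time n K stop = (\<lambda>(x, y, u).
     let stops = (\<lambda>k. k \<le> n \<and> stop k (sample_data n K y, observed k x, u))
     in if \<exists>k. stops k then Some (LEAST k. stops k) else None)"

definition stopped_reward ::
  "nat \<Rightarrow> nat \<Rightarrow> rule \<Rightarrow> (nat \<Rightarrow> real) \<times> (nat \<Rightarrow> nat \<Rightarrow> real) \<times> real \<Rightarrow> real" where
  "stopped_reward n K stop \<omega> =
     (case stopping_time n K stop \<omega> of
        None \<Rightarrow> 0
      | Some k \<Rightarrow> pos_part (walk (fst \<omega>) k))"

end

theory Submission
  imports Defs
begin

text \<open>
  The rule uses the maximum \<open>M'\<close> of a single sample walk as a threshold: it stops at the first time
  the realised walk beats \<open>M'\<close>. A fair coin decides beforehand whether a tie counts as a win, so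
  that the realised maximum \<open>M\<close> beats \<open>M'\<close> with probability exactly 1/2 whatever the atoms of
  \<open>F\<close>. Let \<open>R\<close> be the reward of this rule. Two lower bounds on \<open>E R\<close> are combined.

  First, \<open>R \<ge> M'\<close> whenever \<open>M\<close> beats \<open>M'\<close> (\<open>hit_reward_ge\<close>); as \<open>M\<close> and \<open>M'\<close> are
  exchangeable, \<open>2 E R \<ge> E min M M'\<close>. This is weak when \<open>M\<close> is rarely large, where the
  overshoot over the threshold matters. It is controlled by the second bound: after the hitting time
  the walk starts afresh, so the maximum exceeds the stopped value by at most the
  maximum of an independent walk with no more steps, whose expectation is at most \<open>E M\<close>. Hence, for each threshold, the expectation of \<open>M\<close> on the event of a hit is at most the
  expected reward plus \<open>E M\<close> times the hitting probability (\<open>expected_max_on_hit_le\<close>). Averaging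
  over \<open>M'\<close> and the coin gives \<open>E max M M' \<le> 2 E R + E M\<close>.

  Adding the two bounds and using \<open>min M M' + max M M' = M + M'\<close> leaves \<open>E M \<le> 4 E R\<close>. The
  exchangeability argument and this addition are \<open>expected_max_le_two_rewards\<close>, in which the two
  outcomes of the coin appear separately. Expectations are computed as nonnegative integrals, so
  integrability of \<open>M\<close> enters only to cancel \<open>E M\<close> and to return to Lebesgue integrals.
\<close>

section \<open>The walk and its restarts\<close>

lemma walk_0 [simp]: "walk x 0 = 0"
  by (simp add: walk_def)

lemma walk_restrict: "k \<le> m \<Longrightarrow> walk (restrict x {1..m}) k = walk x k"
  unfolding walk_def by (intro sum.cong) auto

lemma walk_split: "k \<le> j \<Longrightarrow> walk x j = walk x k + walk (\<lambda>i. x (i + k)) (j - k)"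
proof -
  assume "k \<le> j"
  have "{1..j} = {1..k} \<union> {1+k..j}"
    using \<open>k \<le> j\<close> by auto
  then have "walk x j = walk x k + (\<Sum>i=1+k..j. x i)"
    unfolding walk_def by (simp add: sum.union_disjoint)
  also have "(\<Sum>i=1+k..j. x i) = walk (\<lambda>i. x (i + k)) (j - k)"
    unfolding walk_def
    using sum.shift_bounds_cl_nat_ivl[of x 1 k "j - k"] \<open>k \<le> j\<close> by simp
  finally show ?thesis .
qed

lemma walk_le_max: "k \<le> n \<Longrightarrow> walk x k \<le> walk_max n x"
  unfolding walk_max_def by (intro Max_ge) auto

lemma walk_max_nonneg: "0 \<le> walk_max n x"
  using walk_le_max[of 0 n x] by simp

lemma walk_max_attained: "\<exists>k\<le>n. walk_max n x = walk x k"
proof -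
  have "walk_max n x \<in> walk x ` {0..n}"
    unfolding walk_max_def by (intro Max_in) auto
  then show ?thesis by auto
qed

lemma walk_max_mono: "m \<le> n \<Longrightarrow> walk_max m x \<le> walk_max n x"
  by (metis order_trans walk_le_max walk_max_attained)

lemma walk_max_cong: "(\<And>i. i \<in> {1..n} \<Longrightarrow> x i = x' i) \<Longrightarrow> walk_max n x = walk_max n x'"
  unfolding walk_max_def walk_def
  by (intro arg_cong[of _ _ Max] image_cong sum.cong) auto

text \<open>The maximum is a function of the sample data, which contain positive parts only, because the
  walk starts at 0.\<close>

lemma walk_max_pos_part: "walk_max n x = Max ((\<lambda>k. pos_part (walk x k)) ` {0..n})"
proof (rule antisym)
  obtain k where k: "k \<le> n" "walk_max n x = walk x k"
    using walk_max_attained by blast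
  have "walk_max n x \<le> pos_part (walk x k)"
    using k by (simp add: pos_part_def)
  also have "\<dots> \<le> Max ((\<lambda>k. pos_part (walk x k)) ` {0..n})"
    using k by (intro Max_ge) auto
  finally show "walk_max n x \<le> Max ((\<lambda>k. pos_part (walk x k)) ` {0..n})" .
  show "Max ((\<lambda>k. pos_part (walk x k)) ` {0..n}) \<le> walk_max n x"
    using walk_le_max walk_max_nonneg by (auto simp: pos_part_def)
qed

section \<open>Stopping when the walk first satisfies a predicate\<close>

definition first_hit :: "(real \<Rightarrow> bool) \<Rightarrow> nat \<Rightarrow> (nat \<Rightarrow> real) \<Rightarrow> bool" where
  "first_hit P k x \<longleftrightarrow> P (walk x k) \<and> (\<forall>j<k. \<not> P (walk x j))"

text \<open>At most one summand is nonzero. The reward is written as a sum, not with a least element,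
  because measurability and the decomposition over the hitting time are then immediate.\<close>

definition hit_reward :: "(real \<Rightarrow> bool) \<Rightarrow> nat \<Rightarrow> (nat \<Rightarrow> real) \<Rightarrow> real" where
  "hit_reward P n x = (\<Sum>k\<le>n. if first_hit P k x then pos_part (walk x k) else 0)"

lemma first_hit_unique: "first_hit P k x \<Longrightarrow> first_hit P j x \<Longrightarrow> j = k"
  unfolding first_hit_def by (meson linorder_neqE_nat)

lemma first_hit_exists:
  assumes "P (walk x j)"
  obtains k where "k \<le> j" "first_hit P k x"
proof
  show "(LEAST k. P (walk x k)) \<le> j"
    using assms by (rule Least_le)
  show "first_hit P (LEAST k. P (walk x k)) x"
    unfolding first_hit_def using assms by (auto intro: LeastI dest: not_less_Least)
qed

lemma sum_first_hit:
  fixes f :: "nat \<Rightarrow> 'a::comm_monoid_add"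
  assumes "first_hit P k x" "k \<le> n"
  shows "(\<Sum>j\<le>n. if first_hit P j x then f j else 0) = f k"
proof -
  have "(\<Sum>j\<le>n. if first_hit P j x then f j else 0) = (\<Sum>j\<le>n. if j = k then f j else 0)"
    by (intro sum.cong refl) (metis assms(1) first_hit_unique)
  then show ?thesis using assms by simp
qed

text \<open>Since the predicate is upward closed, it holds somewhere along the walk only if it holds
  at the maximum.\<close>

lemma sum_no_hit:
  fixes f :: "nat \<Rightarrow> 'a::comm_monoid_add"
  assumes "mono P" "\<not> P (walk_max n x)"
  shows "(\<Sum>j\<le>n. if first_hit P j x then f j else 0) = 0"
proof (intro sum.neutral ballI)
  fix j assume "j \<in> {..n}"
  then have "walk x j \<le> walk_max n x" by (simp add: walk_le_max)
  then have "\<not> P (walk x j)"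
    using assms by (metis le_boolD monoD)
  then show "(if first_hit P j x then f j else 0) = 0"
    by (simp add: first_hit_def)
qed

lemma max_hit:
  assumes "P (walk_max n x)"
  obtains k j where "k \<le> j" "j \<le> n" "walk_max n x = walk x j" "first_hit P k x"
  using assms walk_max_attained by (metis first_hit_exists)

lemma hit_reward_nonneg: "0 \<le> hit_reward P n x"
  unfolding hit_reward_def by (intro sum_nonneg) (auto simp: pos_part_def)

lemma hit_reward_ge:
  assumes "P (walk_max n x)" "\<And>s. P s \<Longrightarrow> c \<le> pos_part s"
  shows "c \<le> hit_reward P n x"
proof -
  obtain k j where kj: "k \<le> j" "j \<le> n" "first_hit P k x"
    using assms(1) by (rule max_hit)
  then have "hit_reward P n x = pos_part (walk x k)"
    unfolding hit_reward_def by (intro sum_first_hit) auto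
  moreover have "c \<le> pos_part (walk x k)"
    using kj assms(2) by (simp add: first_hit_def)
  ultimately show ?thesis by simp
qed

lemma hit_reward_le_max:
  assumes "mono P"
  shows "hit_reward P n x \<le> walk_max n x"
proof (cases "P (walk_max n x)")
  case True
  then obtain k j where "k \<le> j" "j \<le> n" "first_hit P k x"
    by (rule max_hit)
  then have "hit_reward P n x = pos_part (walk x k)" "k \<le> n"
    unfolding hit_reward_def by (auto intro: sum_first_hit)
  then show ?thesis
    using walk_le_max walk_max_nonneg by (simp add: pos_part_def)
next
  case False
  then show ?thesis
    using assms by (simp add: hit_reward_def sum_no_hit walk_max_nonneg)
qed

text \<open>The maximum is attained no earlier than the hitting time \<open>k\<close>, so it is the value at
  \<open>k\<close> plus a value of the walk restarted at \<open>k\<close>.\<close>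

lemma max_le_reward_plus_restart:
  assumes "P (walk_max n x)"
  shows "walk_max n x \<le> hit_reward P n x +
    (\<Sum>k\<le>n. if first_hit P k x then walk_max (n - k) (\<lambda>i. x (i + k)) else 0)"
proof -
  obtain k j where kj: "k \<le> j" "j \<le> n" "walk_max n x = walk x j" "first_hit P k x"
    using assms by (rule max_hit)
  have "walk_max n x = walk x k + walk (\<lambda>i. x (i + k)) (j - k)"
    using kj by (metis walk_split)
  also have "\<dots> \<le> pos_part (walk x k) + walk_max (n - k) (\<lambda>i. x (i + k))"
    using kj by (intro add_mono walk_le_max) (auto simp: pos_part_def)
  also have "pos_part (walk x k) = hit_reward P n x"
    unfolding hit_reward_def using kj by (intro sum_first_hit[symmetric]) auto
  also have "walk_max (n - k) (\<lambda>i. x (i + k)) =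
      (\<Sum>k\<le>n. if first_hit P k x then walk_max (n - k) (\<lambda>i. x (i + k)) else 0)"
    using kj by (intro sum_first_hit[symmetric]) auto
  finally show ?thesis .
qed

section \<open>The price of stopping at the first hit\<close>

lemma measurable_walk:
  assumes "real_distribution F" "k \<le> m"
  shows "(\<lambda>x. walk x k) \<in> borel_measurable (PiM {1..m} (\<lambda>_. F))"
proof -
  interpret real_distribution F by fact
  show ?thesis
    unfolding walk_def using assms(2) by (intro borel_measurable_sum) measurable
qed

lemma measurable_walk_max:
  assumes "real_distribution F" "n \<le> m"
  shows "walk_max n \<in> borel_measurable (PiM {1..m} (\<lambda>_. F))"
  unfolding walk_max_def
  using assms by (intro borel_measurable_Max measurable_walk) auto

lemma measurable_shifted_walk_max:
  assumes "real_distribution F" "{k+1..n} \<subseteq> K"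
  shows "(\<lambda>x. walk_max (n - k) (\<lambda>i. x (i + k))) \<in> borel_measurable (PiM K (\<lambda>_. F))"
proof -
  have *: "walk_max (n - k) (\<lambda>i. x (i + k)) = walk_max (n - k) (\<lambda>i\<in>{1..n - k}. x (i + k))"
    for x :: "nat \<Rightarrow> real"
    by (rule walk_max_cong) simp
  have "(\<lambda>x. \<lambda>i\<in>{1..n - k}. x (i + k)) \<in> PiM K (\<lambda>_. F) \<rightarrow>\<^sub>M PiM {1..n - k} (\<lambda>_. F)"
    using assms(2) by (intro measurable_restrict measurable_component_singleton) auto
  from measurable_compose[OF this measurable_walk_max[OF assms(1) order_refl]] show ?thesis
    unfolding * .
qed

lemma measurable_first_hit:
  assumes P: "\<And>j. j \<le> k \<Longrightarrow> Measurable.pred N (\<lambda>\<omega>. P \<omega> (walk (X \<omega>) j))"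
  shows "Measurable.pred N (\<lambda>\<omega>. first_hit (P \<omega>) k (X \<omega>))"
proof -
  have "Measurable.pred N (\<lambda>\<omega>. \<forall>j\<in>{..<k}. \<not> P \<omega> (walk (X \<omega>) j))"
    using P by (intro pred_intros_finite) auto
  then have "Measurable.pred N (\<lambda>\<omega>. P \<omega> (walk (X \<omega>) k) \<and> (\<forall>j\<in>{..<k}. \<not> P \<omega> (walk (X \<omega>) j)))"
    using P[OF order_refl] by measurable
  then show ?thesis
    by (simp add: first_hit_def Ball_def)
qed

lemma measurable_hit_reward:
  assumes X: "\<And>k. k \<le> n \<Longrightarrow> (\<lambda>\<omega>. walk (X \<omega>) k) \<in> borel_measurable N"
    and P: "\<And>k. k \<le> n \<Longrightarrow> Measurable.pred N (\<lambda>\<omega>. P \<omega> (walk (X \<omega>) k))"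
  shows "(\<lambda>\<omega>. hit_reward (P \<omega>) n (X \<omega>)) \<in> borel_measurable N"
  unfolding hit_reward_def
proof (intro borel_measurable_sum)
  fix k assume "k \<in> {..n}"
  then have "Measurable.pred N (\<lambda>\<omega>. first_hit (P \<omega>) k (X \<omega>))"
    and "(\<lambda>\<omega>. walk (X \<omega>) k) \<in> borel_measurable N"
    using X P by (auto intro: measurable_first_hit)
  then show "(\<lambda>\<omega>. if first_hit (P \<omega>) k (X \<omega>) then pos_part (walk (X \<omega>) k) else 0)
      \<in> borel_measurable N"
    unfolding pos_part_def by measurable
qed

text \<open>Only selections of distinct coordinates of an i.i.d. family occur: \<open>f i = i + k\<close> describes
  the restarted walk and \<open>f i = i\<close> a shortened one.\<close>

lemma nn_integral_PiM_reindex: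
  assumes "real_distribution F" "inj_on f I" "f \<in> I \<rightarrow> K"
    and g: "g \<in> borel_measurable (PiM I (\<lambda>_. F))"
  shows "(\<integral>\<^sup>+x. g (\<lambda>i\<in>I. x (f i)) \<partial>PiM K (\<lambda>_. F)) = (\<integral>\<^sup>+x. g x \<partial>PiM I (\<lambda>_. F))"
proof -
  interpret real_distribution F by fact
  have *: "(\<lambda>x. \<lambda>i\<in>I. x (f i)) \<in> PiM K (\<lambda>_. F) \<rightarrow>\<^sub>M PiM I (\<lambda>_. F)"
    using assms(3) by (intro measurable_restrict measurable_component_singleton) auto
  have "(\<integral>\<^sup>+x. g x \<partial>PiM I (\<lambda>_. F)) =
      (\<integral>\<^sup>+x. g x \<partial>distr (PiM K (\<lambda>_. F)) (PiM I (\<lambda>_. F)) (\<lambda>x. \<lambda>i\<in>I. x (f i)))"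
    using distr_PiM_reindex[of K "\<lambda>_. F" f I] assms prob_space_axioms by simp
  also have "\<dots> = (\<integral>\<^sup>+x. g (\<lambda>i\<in>I. x (f i)) \<partial>PiM K (\<lambda>_. F))"
    using * g by (intro nn_integral_distr) auto
  finally show ?thesis ..
qed

text \<open>The weight \<open>\<phi>\<close> depends on the first \<open>k\<close> increments and the restarted maximum on the
  remaining ones, so the expectation factorises; the second factor is the expected maximum over
  \<open>n - k\<close> steps, which is at most that over \<open>n\<close> steps.\<close>

lemma expected_restart_le:
  assumes F: "real_distribution F" and "k \<le> n"
    and \<phi>': "\<phi> \<in> borel_measurable (PiM {1..k} (\<lambda>_. F))"
    and past': "\<And>x. \<phi> (restrict x {1..k}) = \<phi> x"
  shows "(\<integral>\<^sup>+x. \<phi> x * ennreal (walk_max (n - k) (\<lambda>i. x (i + k))) \<partial>increments n F)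
    \<le> (\<integral>\<^sup>+x. \<phi> x \<partial>increments n F) * (\<integral>\<^sup>+x. ennreal (walk_max n x) \<partial>increments n F)"
proof -
  interpret F: real_distribution F by fact
  interpret P: product_sigma_finite "\<lambda>_. F" by unfold_locales
  let ?P = "\<lambda>I::nat set. PiM I (\<lambda>_. F)"
  define I where "I = {1..k}"
  define J where "J = {k+1..n}"
  define G where "G = (\<lambda>x::nat\<Rightarrow>real. ennreal (walk_max (n - k) (\<lambda>i. x (i + k))))"
  have IJ: "I \<union> J = {1..n}" "I \<inter> J = {}" "finite I" "finite J" "J \<subseteq> {1..n}"
    unfolding I_def J_def using \<open>k \<le> n\<close> by auto
  note \<phi> = \<phi>'[folded I_def] and past = past'[folded I_def]
  have M: "(\<lambda>x. ennreal (walk_max (n - k) x)) \<in> borel_measurable (?P {1..n - k})"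
    using measurable_walk_max[OF F] by simp
  have G_shift: "G x = ennreal (walk_max (n - k) (\<lambda>i\<in>{1..n - k}. x (i + k)))" for x
    unfolding G_def by (intro arg_cong[of _ _ ennreal] walk_max_cong) auto
  have G_meas: "G \<in> borel_measurable (?P K)" if "J \<subseteq> K" for K
    unfolding G_def using measurable_shifted_walk_max[OF F that[unfolded J_def]] by simp
  have \<phi>_meas: "\<phi> \<in> borel_measurable (?P {1..n})"
  proof -
    have "(\<lambda>x. restrict x I) \<in> ?P {1..n} \<rightarrow>\<^sub>M ?P I"
      using IJ by (intro measurable_restrict_subset) auto
    from measurable_compose[OF this \<phi>] show ?thesis
      unfolding past .
  qed
  have \<phi>_merge: "\<phi> (merge I J (x, y)) = \<phi> x" for x y
    using past[of "merge I J (x, y)"] past[of x] IJ by simp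
  have G_merge: "G (merge I J (x, y)) = G y" for x y
    unfolding G_def
    by (intro arg_cong[of _ _ ennreal] walk_max_cong) (auto simp: merge_def I_def J_def)
  have G_le: "(\<integral>\<^sup>+y. G y \<partial>?P J) \<le> (\<integral>\<^sup>+x. ennreal (walk_max n x) \<partial>?P {1..n})"
  proof -
    have "(\<integral>\<^sup>+y. G y \<partial>?P J) = (\<integral>\<^sup>+x. ennreal (walk_max (n - k) x) \<partial>?P {1..n - k})"
      unfolding G_shift using M by (intro nn_integral_PiM_reindex[OF F]) (auto simp: J_def)
    also have "\<dots> = (\<integral>\<^sup>+x. ennreal (walk_max (n - k) (\<lambda>i\<in>{1..n - k}. x i)) \<partial>?P {1..n})"
      using M by (intro nn_integral_PiM_reindex[OF F, symmetric]) auto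
    also have "\<dots> \<le> (\<integral>\<^sup>+x. ennreal (walk_max n x) \<partial>?P {1..n})"
    proof (intro nn_integral_mono ennreal_leI)
      fix x :: "nat \<Rightarrow> real"
      have "walk_max (n - k) (\<lambda>i\<in>{1..n - k}. x i) = walk_max (n - k) x"
        by (rule walk_max_cong) simp
      then show "walk_max (n - k) (\<lambda>i\<in>{1..n - k}. x i) \<le> walk_max n x"
        using walk_max_mono[of "n - k" n x] by simp
    qed
    finally show ?thesis .
  qed
  interpret J: prob_space "?P J"
    by (intro prob_space_PiM F.prob_space_axioms)
  have \<phi>_int: "(\<integral>\<^sup>+x. \<phi> x \<partial>?P {1..n}) = (\<integral>\<^sup>+x. \<phi> x \<partial>?P I)"
    using P.product_nn_integral_fold[of I J \<phi>] IJ \<phi>_meas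
    by (simp add: \<phi>_merge J.emeasure_space_1)
  have "(\<integral>\<^sup>+x. \<phi> x * G x \<partial>?P {1..n}) = (\<integral>\<^sup>+x. \<integral>\<^sup>+y. \<phi> x * G y \<partial>?P J \<partial>?P I)"
    using P.product_nn_integral_fold[of I J "\<lambda>x. \<phi> x * G x"] IJ \<phi>_meas G_meas[of "{1..n}"]
    by (simp add: \<phi>_merge G_merge)
  also have "\<dots> = (\<integral>\<^sup>+x. \<phi> x \<partial>?P I) * (\<integral>\<^sup>+y. G y \<partial>?P J)"
    using \<phi> G_meas[of J] by (simp add: nn_integral_cmult nn_integral_multc)
  also have "\<dots> \<le> (\<integral>\<^sup>+x. \<phi> x \<partial>?P {1..n}) * (\<integral>\<^sup>+x. ennreal (walk_max n x) \<partial>?P {1..n})"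
    unfolding \<phi>_int using G_le by (rule mult_left_mono) simp
  finally show ?thesis
    unfolding increments_def G_def .
qed

text \<open>The pathwise bound is split according to the hitting time \<open>k\<close>. The event that the first hit
  occurs at \<open>k\<close> is decided by the first \<open>k\<close> increments, so it is independent of the restarted
  walk, and its probabilities add up to the hitting probability.\<close>

lemma expected_max_on_hit_le:
  assumes F: "real_distribution F" and P: "mono P" "Measurable.pred borel P"
  shows "(\<integral>\<^sup>+x. (if P (walk_max n x) then ennreal (walk_max n x) else 0) \<partial>increments n F)
    \<le> (\<integral>\<^sup>+x. ennreal (hit_reward P n x) \<partial>increments n F)
      + (\<integral>\<^sup>+x. (if P (walk_max n x) then 1 else 0) \<partial>increments n F)
        * (\<integral>\<^sup>+x. ennreal (walk_max n x) \<partial>increments n F)"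
proof -
  interpret F: real_distribution F by fact
  let ?Q = "increments n F"
  define h :: "nat \<Rightarrow> (nat \<Rightarrow> real) \<Rightarrow> ennreal"
    where "h k x = (if first_hit P k x then 1 else 0)" for k x
  define G where "G k x = ennreal (walk_max (n - k) (\<lambda>i. x (i + k)))" for k and x :: "nat \<Rightarrow> real"
  have P_walk: "Measurable.pred (PiM {1..m} (\<lambda>_. F)) (\<lambda>x. P (walk x k))" if "k \<le> m" for k m
    using measurable_compose[OF measurable_walk[OF F that] P(2)] .
  then have "Measurable.pred (PiM {1..m} (\<lambda>_. F)) (first_hit P k)" if "k \<le> m" for k m
    using that by (intro measurable_first_hit) simp
  then have h_meas: "h k \<in> borel_measurable (PiM {1..m} (\<lambda>_. F))" if "k \<le> m" for k m
    unfolding h_def using that by measurable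
  have W: "(\<lambda>x. ennreal (walk_max n x)) \<in> borel_measurable ?Q"
    using measurable_walk_max[OF F] by (simp add: increments_def)
  have R: "(\<lambda>x. ennreal (hit_reward P n x)) \<in> borel_measurable ?Q"
    unfolding increments_def
    using measurable_hit_reward[of n "\<lambda>x. x" _ "\<lambda>_. P"] measurable_walk[OF F] P_walk by simp
  have G_meas: "G k \<in> borel_measurable ?Q" for k
    unfolding G_def increments_def using measurable_shifted_walk_max[OF F, of k n "{1..n}"] by simp
  have past: "h k (restrict x {1..k}) = h k x" for k x
  proof -
    have "walk (restrict x {1..k}) j = walk x j" if "j \<le> k" for j
      using that by (rule walk_restrict)
    then show ?thesis by (auto simp: h_def first_hit_def)
  qed
  have ptw: "(if P (walk_max n x) then ennreal (walk_max n x) else 0)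
      \<le> ennreal (hit_reward P n x) + (\<Sum>k\<le>n. h k x * G k x)" for x
  proof (cases "P (walk_max n x)")
    case True
    have "ennreal (walk_max n x) \<le> ennreal (hit_reward P n x +
        (\<Sum>k\<le>n. if first_hit P k x then walk_max (n - k) (\<lambda>i. x (i + k)) else 0))"
      using True by (intro ennreal_leI max_le_reward_plus_restart)
    also have "\<dots> = ennreal (hit_reward P n x) +
        (\<Sum>k\<le>n. ennreal (if first_hit P k x then walk_max (n - k) (\<lambda>i. x (i + k)) else 0))"
      by (simp add: hit_reward_nonneg walk_max_nonneg sum_nonneg)
    also have "(\<Sum>k\<le>n. ennreal (if first_hit P k x then walk_max (n - k) (\<lambda>i. x (i + k)) else 0))
        = (\<Sum>k\<le>n. h k x * G k x)"
      by (intro sum.cong) (auto simp: h_def G_def)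
    finally show ?thesis using True by simp
  qed simp
  have sum_h: "(\<Sum>k\<le>n. h k x) = (if P (walk_max n x) then 1 else 0)" for x
  proof (cases "P (walk_max n x)")
    case True
    then obtain k j where "k \<le> j" "j \<le> n" "first_hit P k x"
      by (rule max_hit)
    with True show ?thesis
      unfolding h_def by (subst sum_first_hit[of P k]) auto
  qed (simp add: h_def sum_no_hit P)
  have "(\<integral>\<^sup>+x. (if P (walk_max n x) then ennreal (walk_max n x) else 0) \<partial>?Q)
      \<le> (\<integral>\<^sup>+x. ennreal (hit_reward P n x) + (\<Sum>k\<le>n. h k x * G k x) \<partial>?Q)"
    by (intro nn_integral_mono ptw)
  also have "\<dots> = (\<integral>\<^sup>+x. ennreal (hit_reward P n x) \<partial>?Q) + (\<Sum>k\<le>n. \<integral>\<^sup>+x. h k x * G k x \<partial>?Q)"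
  proof -
    have hG: "(\<lambda>x. h k x * G k x) \<in> borel_measurable ?Q" if "k \<le> n" for k
      unfolding increments_def
      using h_meas[OF that] G_meas[of k, unfolded increments_def] by simp
    then have "(\<lambda>x. \<Sum>k\<le>n. h k x * G k x) \<in> borel_measurable ?Q"
      by (intro borel_measurable_sum) simp
    moreover have "(\<integral>\<^sup>+x. (\<Sum>k\<le>n. h k x * G k x) \<partial>?Q) = (\<Sum>k\<le>n. \<integral>\<^sup>+x. h k x * G k x \<partial>?Q)"
      using hG by (intro nn_integral_sum) simp
    ultimately show ?thesis
      using R by (simp add: nn_integral_add)
  qed
  also have "(\<Sum>k\<le>n. \<integral>\<^sup>+x. h k x * G k x \<partial>?Q)
      \<le> (\<Sum>k\<le>n. (\<integral>\<^sup>+x. h k x \<partial>?Q) * (\<integral>\<^sup>+x. ennreal (walk_max n x) \<partial>?Q))"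
    unfolding G_def
    by (intro sum_mono expected_restart_le[OF F] past h_meas) auto
  also have "\<dots> = (\<integral>\<^sup>+x. (\<Sum>k\<le>n. h k x) \<partial>?Q) * (\<integral>\<^sup>+x. ennreal (walk_max n x) \<partial>?Q)"
  proof -
    have "(\<integral>\<^sup>+x. (\<Sum>k\<le>n. h k x) \<partial>?Q) = (\<Sum>k\<le>n. \<integral>\<^sup>+x. h k x \<partial>?Q)"
      unfolding increments_def using h_meas by (intro nn_integral_sum) simp
    then show ?thesis
      by (simp add: sum_distrib_right)
  qed
  finally show ?thesis
    unfolding sum_h by simp
qed

section \<open>One sample walk as a threshold\<close>

text \<open>The outcome \<open>b\<close> of the coin selects the strict or the weak comparison. Comparing the positive
  part makes the predicate observable; for a threshold \<open>c \<ge> 0\<close> it differs from comparing \<open>s\<close>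
  itself only when ties count and \<open>c = 0\<close>, where time 0 already is a hit.\<close>

definition beats :: "bool \<Rightarrow> real \<Rightarrow> real \<Rightarrow> bool" where
  "beats b c s \<longleftrightarrow> (if b then c < pos_part s else c \<le> pos_part s)"

lemma mono_beats: "mono (beats b c)"
  by (intro monoI) (auto simp: beats_def pos_part_def)

lemma beats_measurable:
  assumes "Measurable.pred N b" "c \<in> borel_measurable N" "s \<in> borel_measurable N"
  shows "Measurable.pred N (\<lambda>\<omega>. beats (b \<omega>) (c \<omega>) (s \<omega>))"
  using assms unfolding beats_def pos_part_def by measurable

lemma beats_walk_max: "beats b c (walk_max n x) \<longleftrightarrow> (if b then c < walk_max n x else c \<le> walk_max n x)"
  by (simp add: beats_def pos_part_def walk_max_nonneg)

text \<open>Of two walks compared in both directions exactly one wins, provided ties are resolved oppositely.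
  This replaces the usual assumption that ties have probability 0.\<close>

lemma beats_swap: "beats (\<not> b) (walk_max n x) (walk_max n x') \<longleftrightarrow> \<not> beats b (walk_max n x') (walk_max n x)"
  by (auto simp: beats_walk_max)

text \<open>The expected reward given the outcome of the coin; the outer variable is the sample walk.\<close>

definition expected_reward :: "nat \<Rightarrow> real measure \<Rightarrow> bool \<Rightarrow> ennreal" where
  "expected_reward n F b = (\<integral>\<^sup>+x'. \<integral>\<^sup>+x. ennreal (hit_reward (beats b (walk_max n x')) n x)
     \<partial>increments n F \<partial>increments n F)"

text \<open>In the proof, \<open>T b\<close> and \<open>L b\<close> are the expectations of the maximum of the realised walk and
  of the sample walk on the event that the realised walk wins. Exchanging the two walks turns
  \<open>L (\<not> b)\<close> into the expectation of the realised maximum on the complement of the event in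
  \<open>T b\<close>, so \<open>T b + L (\<not> b)\<close> is the expected maximum; in the same way the two winning
  probabilities add up to 1.\<close>

lemma expected_max_le_two_rewards:
  assumes F: "real_distribution F"
    and fin: "(\<integral>\<^sup>+x. ennreal (walk_max n x) \<partial>increments n F) < \<infinity>"
  shows "(\<integral>\<^sup>+x. ennreal (walk_max n x) \<partial>increments n F) \<le> 2 * (expected_reward n F True + expected_reward n F False)"
proof -
  let ?R = "expected_reward n F"
  interpret F: real_distribution F by fact
  let ?Q = "increments n F"
  interpret Q: prob_space ?Q
    unfolding increments_def by (intro prob_space_PiM F.prob_space_axioms)
  interpret QQ: pair_prob_space ?Q ?Q ..
  define W where "W = (\<lambda>x. ennreal (walk_max n x))"
  define m where "m = (\<integral>\<^sup>+x. W x \<partial>?Q)"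
  define win where "win b x' x = beats b (walk_max n x') (walk_max n x)" for b x' x
  define T where "T b = (\<integral>\<^sup>+x'. \<integral>\<^sup>+x. (if win b x' x then W x else 0) \<partial>?Q \<partial>?Q)" for b
  define L where "L b = (\<integral>\<^sup>+x'. \<integral>\<^sup>+x. (if win b x' x then W x' else 0) \<partial>?Q \<partial>?Q)" for b
  define p where "p b = (\<integral>\<^sup>+x'. \<integral>\<^sup>+x. (if win b x' x then 1 else 0) \<partial>?Q \<partial>?Q)" for b
  have [measurable]: "walk_max n \<in> borel_measurable ?Q"
    unfolding increments_def using measurable_walk_max[OF F] by simp
  have walk_meas: "(\<lambda>x. walk x k) \<in> borel_measurable ?Q" if "k \<le> n" for k
    unfolding increments_def using measurable_walk[OF F that] .
  have [measurable]: "W \<in> borel_measurable ?Q"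
    unfolding W_def by measurable
  have win_meas [measurable]: "Measurable.pred (?Q \<Otimes>\<^sub>M ?Q) (\<lambda>z. win b (fst z) (snd z))" for b
    unfolding win_def by (intro beats_measurable) measurable
  have [measurable]: "Measurable.pred (?Q \<Otimes>\<^sub>M ?Q) (\<lambda>z. win b (snd z) (fst z))" for b
    unfolding win_def by (intro beats_measurable) measurable
  have [measurable]: "Measurable.pred ?Q (win b x')" for b x'
    unfolding win_def by (intro beats_measurable) measurable
  have [measurable]: "Measurable.pred ?Q (\<lambda>x'. win b x' x)" for b x
    unfolding win_def by (intro beats_measurable) measurable
  have [measurable]: "(\<lambda>z. ennreal (hit_reward (beats b (walk_max n (fst z))) n (snd z)))
      \<in> borel_measurable (?Q \<Otimes>\<^sub>M ?Q)" for b
  proof -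
    have "(\<lambda>z. hit_reward (beats b (walk_max n (fst z))) n (snd z)) \<in> borel_measurable (?Q \<Otimes>\<^sub>M ?Q)"
      by (intro measurable_hit_reward beats_measurable)
        (use measurable_compose[OF measurable_snd walk_meas] in measurable)
    then show ?thesis by measurable
  qed
  have win_swap: "win (\<not> b) x x' \<longleftrightarrow> \<not> win b x' x" for b x x'
    unfolding win_def by (rule beats_swap)
  have T_le: "T b \<le> ?R b + p b * m" for b
  proof -
    have "T b \<le> (\<integral>\<^sup>+x'. (\<integral>\<^sup>+x. ennreal (hit_reward (beats b (walk_max n x')) n x) \<partial>?Q)
        + (\<integral>\<^sup>+x. (if win b x' x then 1 else 0) \<partial>?Q) * m \<partial>?Q)"
      unfolding T_def m_def W_def win_def
      by (intro nn_integral_mono expected_max_on_hit_le[OF F] mono_beats beats_measurable) measurable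
    also have "\<dots> = ?R b + p b * m"
      unfolding expected_reward_def p_def
      by (subst nn_integral_add) (measurable, simp add: nn_integral_multc)
    finally show ?thesis .
  qed
  have L_le: "L b \<le> ?R b" for b
    unfolding L_def expected_reward_def
  proof (intro nn_integral_mono)
    fix x' x
    show "(if win b x' x then W x' else 0) \<le> ennreal (hit_reward (beats b (walk_max n x')) n x)"
      unfolding win_def W_def
      by (auto intro!: ennreal_leI hit_reward_ge simp: beats_def split: if_splits)
  qed
  have p_sum: "p b + p (\<not> b) = 1" for b
  proof -
    have "p (\<not> b) = (\<integral>\<^sup>+x'. \<integral>\<^sup>+x. (if win (\<not> b) x x' then 1 else 0) \<partial>?Q \<partial>?Q)"
      unfolding p_def by (rule QQ.Fubini') measurable
    then have "p b + p (\<not> b) = (\<integral>\<^sup>+x'. \<integral>\<^sup>+x. (if win b x' x then 1 else 0) +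
        (if win (\<not> b) x x' then 1 else 0) \<partial>?Q \<partial>?Q)"
      unfolding p_def by (simp add: nn_integral_add)
    also have "\<dots> = (\<integral>\<^sup>+x'. \<integral>\<^sup>+x. 1 \<partial>?Q \<partial>?Q)"
      by (intro nn_integral_cong) (simp add: win_swap)
    finally show ?thesis by (simp add: Q.emeasure_space_1)
  qed
  have TL_sum: "T b + L (\<not> b) = m" for b
  proof -
    have "L (\<not> b) = (\<integral>\<^sup>+x'. \<integral>\<^sup>+x. (if win (\<not> b) x x' then W x else 0) \<partial>?Q \<partial>?Q)"
      unfolding L_def by (rule QQ.Fubini') measurable
    then have "T b + L (\<not> b) = (\<integral>\<^sup>+x'. \<integral>\<^sup>+x. (if win b x' x then W x else 0) +
        (if win (\<not> b) x x' then W x else 0) \<partial>?Q \<partial>?Q)"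
      unfolding T_def by (simp add: nn_integral_add)
    also have "\<dots> = (\<integral>\<^sup>+x'. \<integral>\<^sup>+x. W x \<partial>?Q \<partial>?Q)"
      by (intro nn_integral_cong) (simp add: win_swap)
    finally show ?thesis by (simp add: m_def Q.emeasure_space_1)
  qed
  have "m + m = (T True + L False) + (T False + L True)"
    using TL_sum[of True] TL_sum[of False] by simp
  also have "\<dots> \<le> (?R True + p True * m + ?R False) + (?R False + p False * m + ?R True)"
    by (intro add_mono T_le L_le)
  also have "\<dots> = 2 * (?R True + ?R False) + (p True + p False) * m"
    by (simp add: algebra_simps mult_2)
  also have "\<dots> = 2 * (?R True + ?R False) + m"
    using p_sum[of True] by simp
  finally have "m \<le> 2 * (?R True + ?R False)"
    using fin by (auto simp: m_def W_def)
  then show ?thesis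
    by (simp add: m_def W_def)
qed

section \<open>The stopping rule\<close>

definition fair_coin :: "real measure" where
  "fair_coin = distr (measure_pmf (bernoulli_pmf (1/2))) borel of_bool"

text \<open>The value at time 0 is not part of the observations, but it is always 0.\<close>

definition sample_max_rule :: "nat \<Rightarrow> rule" where
  "sample_max_rule n k = (\<lambda>(d, r, u).
     beats (0 < u) (Max ((\<lambda>t. d (t, 1)) ` {0..n})) (if k = 0 then 0 else r k))"

lemma real_distribution_fair_coin: "real_distribution fair_coin"
proof -
  interpret prob_space fair_coin
    unfolding fair_coin_def
    by (intro prob_space.prob_space_distr prob_space_measure_pmf) simp
  show ?thesis
    by unfold_locales (simp add: fair_coin_def)
qed

lemma nn_integral_fair_coin:
  assumes "f \<in> borel_measurable borel"
  shows "(\<integral>\<^sup>+u. f u \<partial>fair_coin) = (f 1 + f 0) / 2"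
proof -
  have half: "ennreal (1 / 2) = 1 / 2"
    by (simp add: divide_ennreal flip: ennreal_numeral ennreal_1)
  have "(\<integral>\<^sup>+u. f u \<partial>fair_coin) = (\<integral>\<^sup>+b. f (of_bool b) \<partial>bernoulli_pmf (1/2))"
    unfolding fair_coin_def using assms by (subst nn_integral_distr) auto
  also have "\<dots> = f 1 * (1 / 2) + f 0 * (1 / 2)"
    using half by simp
  also have "\<dots> = (f 1 + f 0) / 2"
    by (simp add: divide_ennreal_def distrib_right)
  finally show ?thesis .
qed

lemma randomised_stopping_rule_sample_max:
  assumes "K \<ge> 1"
  shows "randomised_stopping_rule n K fair_coin (sample_max_rule n)"
  unfolding randomised_stopping_rule_def
proof (intro conjI allI impI)
  interpret real_distribution fair_coin by (rule real_distribution_fair_coin)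
  show "real_distribution fair_coin" by (rule real_distribution_fair_coin)
  fix k assume "k \<le> n"
  let ?D = "PiM ({0..n} \<times> {1..K}) (\<lambda>_. borel) :: (nat \<times> nat \<Rightarrow> real) measure"
  let ?N = "?D \<Otimes>\<^sub>M (PiM {1..k} (\<lambda>_. borel :: real measure) \<Otimes>\<^sub>M fair_coin)"
  have 1: "Measurable.pred ?N (\<lambda>z. 0 < snd (snd z))"
    by measurable
  have 2: "(\<lambda>z. Max ((\<lambda>t. fst z (t, 1)) ` {0..n})) \<in> borel_measurable ?N"
  proof (intro borel_measurable_Max)
    fix t assume "t \<in> {0..n}"
    then have "(\<lambda>d. d (t, 1)) \<in> borel_measurable ?D"
      using assms by (intro measurable_component_singleton) auto
    then show "(\<lambda>z. fst z (t, 1)) \<in> borel_measurable ?N"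
      by (rule measurable_compose[OF measurable_fst])
  qed simp
  have 3: "(\<lambda>z. if k = 0 then 0 else fst (snd z) k) \<in> borel_measurable ?N"
  proof (cases "k = 0")
    case False
    then have "(\<lambda>r. r k) \<in> borel_measurable (PiM {1..k} (\<lambda>_. borel :: real measure))"
      by (intro measurable_component_singleton) auto
    with False show ?thesis by simp
  qed simp
  show "sample_max_rule n k \<in> ?N \<rightarrow>\<^sub>M count_space UNIV"
    using beats_measurable[OF 1 2 3] by (simp add: sample_max_rule_def case_prod_beta)
qed

lemma stopped_reward_sample_max:
  assumes "K \<ge> 1"
  shows "stopped_reward n K (sample_max_rule n) (x, y, u) =
    hit_reward (beats (0 < u) (walk_max n (y 1))) n x"
proof -
  let ?P = "beats (0 < u) (walk_max n (y 1))"
  have max_eq: "Max ((\<lambda>t. sample_data n K y (t, 1)) ` {0..n}) = walk_max n (y 1)"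
    unfolding walk_max_pos_part using assms
    by (intro arg_cong[of _ _ Max] image_cong) (auto simp: sample_data_def)
  have obs: "beats b c (if k = 0 then 0 else observed k x k) \<longleftrightarrow> beats b c (walk x k)" for b c k
    by (auto simp: observed_def beats_def pos_part_def)
  have stops: "sample_max_rule n k (sample_data n K y, observed k x, u) \<longleftrightarrow> ?P (walk x k)" for k
    by (simp only: sample_max_rule_def prod.case max_eq obs)
  show ?thesis
  proof (cases "\<exists>k\<le>n. ?P (walk x k)")
    case True
    let ?k = "LEAST k. k \<le> n \<and> ?P (walk x k)"
    have k: "?k \<le> n \<and> ?P (walk x ?k)"
      using True by (rule LeastI_ex)
    have "\<not> ?P (walk x j)" if "j < ?k" for j
      using not_less_Least[OF that] that k by linarith
    with k have "first_hit ?P ?k x"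
      by (simp add: first_hit_def)
    then have "hit_reward ?P n x = pos_part (walk x ?k)"
      unfolding hit_reward_def using k by (intro sum_first_hit) auto
    then show ?thesis
      using True by (simp add: stopped_reward_def stopping_time_def stops)
  next
    case False
    then have "hit_reward ?P n x = 0"
      unfolding hit_reward_def by (intro sum.neutral) (auto simp: first_hit_def)
    then show ?thesis
      by (subst stopped_reward_def) (use False in \<open>auto simp: stopping_time_def stops Let_def\<close>)
  qed
qed

lemma nn_integral_stopped_reward:
  assumes F: "real_distribution F" and "K \<ge> 1"
  shows "(\<integral>\<^sup>+\<omega>. ennreal (stopped_reward n K (sample_max_rule n) \<omega>) \<partial>joint_law n K fair_coin F)
      = (expected_reward n F True + expected_reward n F False) / 2" (is ?int)
    and "stopped_reward n K (sample_max_rule n) \<in> borel_measurable (joint_law n K fair_coin F)" (is ?meas)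
proof -
  interpret F: real_distribution F by fact
  let ?Q = "increments n F"
  let ?Y = "PiM {1..K} (\<lambda>_. ?Q)"
  interpret Q: prob_space ?Q
    unfolding increments_def by (intro prob_space_PiM F.prob_space_axioms)
  interpret Y: prob_space ?Y
    by (intro prob_space_PiM Q.prob_space_axioms)
  interpret A: real_distribution fair_coin
    by (rule real_distribution_fair_coin)
  interpret YA: pair_prob_space ?Y fair_coin ..
  interpret QYA: pair_prob_space ?Q "?Y \<Otimes>\<^sub>M fair_coin" ..
  let ?R = "expected_reward n F"
  let ?J = "?Q \<Otimes>\<^sub>M (?Y \<Otimes>\<^sub>M fair_coin)"
  define r where "r x x' b = hit_reward (beats b (walk_max n x')) n x" for x x' b
  have walk_meas: "(\<lambda>x. walk x k) \<in> borel_measurable ?Q" if "k \<le> n" for k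
    unfolding increments_def using measurable_walk[OF F that] .
  have max_meas: "walk_max n \<in> borel_measurable ?Q"
    unfolding increments_def using measurable_walk_max[OF F] by simp
  have coord: "(\<lambda>y. y 1) \<in> ?Y \<rightarrow>\<^sub>M ?Q"
    using \<open>K \<ge> 1\<close> by (intro measurable_component_singleton) auto
  have r_meas: "(\<lambda>\<omega>. r (X \<omega>) (X' \<omega>) (b \<omega>)) \<in> borel_measurable N"
    if "X \<in> N \<rightarrow>\<^sub>M ?Q" "X' \<in> N \<rightarrow>\<^sub>M ?Q" "Measurable.pred N b"
    for X X' b and N :: "'z measure"
    unfolding r_def
    using measurable_compose[OF that(1) walk_meas] measurable_compose[OF that(2) max_meas] that(3)
    by (intro measurable_hit_reward beats_measurable) auto
  have eq: "stopped_reward n K (sample_max_rule n) =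
      (\<lambda>\<omega>. r (fst \<omega>) (fst (snd \<omega>) 1) (0 < snd (snd \<omega>)))"
    using stopped_reward_sample_max[OF \<open>K \<ge> 1\<close>] by (auto simp: r_def fun_eq_iff)
  have meas: "(\<lambda>\<omega>. r (fst \<omega>) (fst (snd \<omega>) 1) (0 < snd (snd \<omega>))) \<in> borel_measurable ?J"
    by (intro r_meas measurable_compose[OF measurable_compose[OF measurable_snd measurable_fst] coord])
      measurable
  then show ?meas
    unfolding eq joint_law_def .
  define h where "h b x' = (\<integral>\<^sup>+x. ennreal (r x x' b) \<partial>?Q)" for b x'
  have h_meas: "h b \<in> borel_measurable ?Q" for b
  proof -
    have "(\<lambda>z. r (snd z) (fst z) b) \<in> borel_measurable (?Q \<Otimes>\<^sub>M ?Q)"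
      by (intro r_meas) measurable
    then show ?thesis
      unfolding h_def by measurable
  qed
  have hu_meas: "(\<lambda>z. h (0 < snd z) (fst z 1)) \<in> borel_measurable (?Y \<Otimes>\<^sub>M fair_coin)"
  proof -
    have "(\<lambda>z. r (snd z) (fst (fst z) 1) (0 < snd (fst z))) \<in> borel_measurable ((?Y \<Otimes>\<^sub>M fair_coin) \<Otimes>\<^sub>M ?Q)"
      by (intro r_meas measurable_compose[OF measurable_compose[OF measurable_fst measurable_fst] coord])
        measurable
    then show ?thesis
      unfolding h_def by measurable
  qed
  have coord_int: "(\<integral>\<^sup>+y. g (y 1) \<partial>?Y) = (\<integral>\<^sup>+x'. g x' \<partial>?Q)" if "g \<in> borel_measurable ?Q" for g
  proof -
    have "distr ?Y ?Q (\<lambda>y. y 1) = ?Q"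
      using \<open>K \<ge> 1\<close> Q.prob_space_axioms by (intro distr_PiM_component) auto
    then show ?thesis
      using nn_integral_distr[OF coord, of g] that by simp
  qed
  have "(\<integral>\<^sup>+\<omega>. ennreal (stopped_reward n K (sample_max_rule n) \<omega>) \<partial>joint_law n K fair_coin F)
      = (\<integral>\<^sup>+z. h (0 < snd z) (fst z 1) \<partial>(?Y \<Otimes>\<^sub>M fair_coin))"
    unfolding eq joint_law_def h_def using meas
    by (subst QYA.nn_integral_snd[symmetric]) (auto simp: case_prod_beta)
  also have "\<dots> = (\<integral>\<^sup>+y. \<integral>\<^sup>+u. h (0 < u) (y 1) \<partial>fair_coin \<partial>?Y)"
    using hu_meas by (subst A.nn_integral_fst[symmetric]) auto
  also have "\<dots> = (\<integral>\<^sup>+y. (h True (y 1) + h False (y 1)) / 2 \<partial>?Y)"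
  proof (intro nn_integral_cong)
    fix y
    have "(\<lambda>u::real. h (0 < u) (y 1)) = (\<lambda>u. if 0 < u then h True (y 1) else h False (y 1))"
      by auto
    then show "(\<integral>\<^sup>+u. h (0 < u) (y 1) \<partial>fair_coin) = (h True (y 1) + h False (y 1)) / 2"
      by (subst nn_integral_fair_coin) auto
  qed
  also have "\<dots> = (\<integral>\<^sup>+x'. (h True x' + h False x') / 2 \<partial>?Q)"
    using h_meas by (intro coord_int borel_measurable_divide_ennreal) auto
  also have "\<dots> = (?R True + ?R False) / 2"
  proof -
    have "?R b = (\<integral>\<^sup>+x'. h b x' \<partial>?Q)" for b
      by (simp add: expected_reward_def h_def r_def)
    then show ?thesis
      using h_meas by (simp add: nn_integral_divide nn_integral_add)
  qed
  finally show ?int .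
qed

theorem mainTheorem5:
  fixes n K :: nat
  assumes "K \<ge> 1"
  shows "\<exists>A stop. randomised_stopping_rule n K A stop \<and>
    (\<forall>F. real_distribution F \<longrightarrow> integrable (increments n F) (walk_max n) \<longrightarrow>
      (LINT \<omega>|joint_law n K A F. stopped_reward n K stop \<omega>)
        \<ge> 1 / 4 * (LINT x|increments n F. walk_max n x))"
proof (intro exI conjI allI impI)
  show "randomised_stopping_rule n K fair_coin (sample_max_rule n)"
    using assms by (rule randomised_stopping_rule_sample_max)
  fix F assume F: "real_distribution F" and int: "integrable (increments n F) (walk_max n)"
  interpret F: real_distribution F by fact
  interpret Q: prob_space "increments n F"
    unfolding increments_def by (intro prob_space_PiM F.prob_space_axioms)
  let ?J = "joint_law n K fair_coin F"
  let ?r = "stopped_reward n K (sample_max_rule n)"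
  let ?R = "expected_reward n F"
  define m where "m = (LINT x|increments n F. walk_max n x)"
  have m: "(\<integral>\<^sup>+x. ennreal (walk_max n x) \<partial>increments n F) = ennreal m"
    unfolding m_def using int by (intro nn_integral_eq_integral) (auto simp: walk_max_nonneg)
  have R_le: "?R b \<le> ennreal m" for b
  proof -
    have "?R b \<le> (\<integral>\<^sup>+x'. \<integral>\<^sup>+x. ennreal (walk_max n x) \<partial>increments n F \<partial>increments n F)"
      unfolding expected_reward_def
      by (intro nn_integral_mono ennreal_leI hit_reward_le_max mono_beats)
    then show ?thesis by (simp add: m Q.emeasure_space_1)
  qed
  have r_nonneg: "0 \<le> ?r \<omega>" for \<omega>
    by (cases \<omega>) (simp add: stopped_reward_sample_max[OF assms] hit_reward_nonneg)
  have r_int: "(\<integral>\<^sup>+\<omega>. ennreal (?r \<omega>) \<partial>?J) = (?R True + ?R False) / 2"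
    using nn_integral_stopped_reward(1)[OF F assms] .
  have m_le: "ennreal m \<le> 2 * (?R True + ?R False)"
    using expected_max_le_two_rewards[OF F, of n] by (simp add: m)
  obtain a b where ab: "?R True = ennreal a" "?R False = ennreal b" "0 \<le> a" "0 \<le> b"
    using R_le[of True] R_le[of False] by (metis ennreal_cases ennreal_less_top leD top.not_eq_extremum)
  have "(LINT \<omega>|?J. ?r \<omega>) = enn2real (\<integral>\<^sup>+\<omega>. ennreal (?r \<omega>) \<partial>?J)"
    using nn_integral_stopped_reward(2)[OF F assms] r_nonneg by (intro integral_eq_nn_integral) auto
  also have "\<dots> = (a + b) / 2"
    unfolding r_int ab(1,2) using ab(3,4)
    by (simp add: divide_ennreal flip: ennreal_plus ennreal_numeral)
  also have "\<dots> \<ge> 1 / 4 * m"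
  proof -
    have "ennreal m \<le> ennreal (2 * (a + b))"
      using m_le ab by (simp add: ennreal_mult)
    then have "m \<le> 2 * (a + b)"
      using ab(3,4) by (subst (asm) ennreal_le_iff) auto
    then show ?thesis by simp
  qed
  finally show "1 / 4 * (LINT x|increments n F. walk_max n x) \<le> (LINT \<omega>|?J. ?r \<omega>)"
    unfolding m_def .
qed

end
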